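(* For every fixed positive integer $m$, $$\lim_{n\to\infty}\frac{\alpha(m,n+2)}{\alpha(m,n)}=\alpha(m,1)^2=\binom{2\lfloor\frac{m+1}{2}\rfloor}{\lfloor\frac{m+1}{2}\rfloor}^2.$$
   Context: For positive integers $m,n$, let $A(m,n)$ be the set of all $m\times n$ matrices with every entry in $\{1,-1\}$ such that every row sum and every column sum has absolute value at most $1$, and let $\alpha(m,n)=|A(m,n)|$. *)

theory Defs
  imports Complex_Main "Jordan_Normal_Form.Matrix"
begin

definition balanced_mats :: "nat \<Rightarrow> nat \<Rightarrow> int mat set" where
  "balanced_mats m n = {M \<in> carrier_mat m n.
     (\<forall>i<m. \<forall>j<n. M $$ (i, j) \<in> {1, -1}) \<and>
     (\<forall>i<m. \<bar>\<Sum>j<n. M $$ (i, j)\<bar> \<le> 1) \<and>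
     (\<forall>j<n. \<bar>\<Sum>i<m. M $$ (i, j)\<bar> \<le> 1)}"

definition alpha :: "nat \<Rightarrow> nat \<Rightarrow> nat" where
  "alpha m n = card (balanced_mats m n)"

end

theory Submission
  imports Defs "HOL-Library.Function_Algebras" "HOL-Real_Asymp.Real_Asymp"
    "HOL-Probability.Characteristic_Functions"
begin

text \<open>
  Read columnwise, a matrix in \<open>A(m,n)\<close> is an \<open>n\<close>-step walk in \<open>\<int>\<^sup>m\<close> with steps in the
  symmetric set \<open>S\<close> of balanced sign columns, ending in the cube \<open>{-1,0,1}\<^sup>m\<close>.
  For even \<open>n = 2k\<close> parity forces the endpoint \<open>0\<close>. The return counts \<open>u\<^sub>k\<close> are log-convex by
  Cauchy--Schwarz, so \<open>u\<^sub>k\<^sub>+\<^sub>1 / u\<^sub>k\<close> increases to a limit at most \<open>\<bar>S\<bar>\<^sup>2\<close>; a smaller limit would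
  contradict \<open>u\<^sub>k \<ge> \<bar>S\<bar>\<^sup>2\<^sup>k / (2k+1)\<^sup>m\<close>, since only polynomially many points are reached in
  \<open>k\<close> steps.
  For odd \<open>n\<close> the endpoints are several. The deficits \<open>u\<^sub>k - w\<^sub>2\<^sub>k(v + v')\<close> for \<open>v, v' \<in> S\<close> are
  nonnegative and sum to \<open>\<bar>S\<bar>\<^sup>2 u\<^sub>k - u\<^sub>k\<^sub>+\<^sub>1 = o(u\<^sub>k)\<close>, and they are subadditive up to a factor
  \<open>2\<close>, so \<open>w\<^sub>2\<^sub>k(x) \<sim> u\<^sub>k\<close> on the whole subgroup generated by \<open>S + S\<close>. All points at distance
  one step from an admissible odd endpoint lie in that subgroup, so the odd counts are
  asymptotic to a constant times \<open>u\<^sub>k\<close>.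
\<close>

section \<open>Symmetric walks on abelian groups\<close>

text \<open>Real-valued although it counts lists of steps, so that inner products and ratios need no
  coercions.\<close>

primrec walks :: "'a::ab_group_add set \<Rightarrow> nat \<Rightarrow> 'a \<Rightarrow> real" where
  "walks S 0 x = (if x = 0 then 1 else 0)"
| "walks S (Suc n) x = (\<Sum>v\<in>S. walks S n (x - v))"

lemma walks_nonneg: "walks S n x \<ge> 0"
  by (induction n arbitrary: x) (auto intro: sum_nonneg)

lemma walks_Suc_nonzeroE:
  assumes "walks S (Suc n) x \<noteq> 0"
  obtains v where "v \<in> S" "walks S n (x - v) \<noteq> 0"
  using assms by (auto elim: sum.not_neutral_contains_not_neutral)

lemma walks_eq_card:
  assumes "finite S"
  shows "walks S n x = card {xs. length xs = n \<and> set xs \<subseteq> S \<and> sum_list xs = x}"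
proof (induction n arbitrary: x)
  case 0
  have "{xs. length xs = 0 \<and> set xs \<subseteq> S \<and> sum_list xs = x} = (if x = 0 then {[]} else {})"
    by auto
  then show ?case by simp
next
  case (Suc n)
  let ?L = "\<lambda>n x. {xs. length xs = n \<and> set xs \<subseteq> S \<and> sum_list xs = x}"
  have fin: "finite (?L n y)" for y
    by (rule finite_subset[OF _ finite_lists_length_eq[OF assms, of n]]) auto
  have "?L (Suc n) x = (\<Union>v\<in>S. Cons v ` ?L n (x - v))"
    by (auto simp: length_Suc_conv image_iff algebra_simps)
  moreover have "card (\<Union>v\<in>S. Cons v ` ?L n (x - v)) = (\<Sum>v\<in>S. card (Cons v ` ?L n (x - v)))"
    by (rule card_UN_disjoint) (use assms fin in auto)
  moreover have "card (Cons v ` ?L n (x - v)) = card (?L n (x - v))" for v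
    by (rule card_image) auto
  ultimately show ?case using Suc by simp
qed

locale symmetric_steps =
  fixes S :: "'a::ab_group_add set"
  assumes finite_S: "finite S"
    and S_nonempty: "S \<noteq> {}"
    and uminus_S: "\<And>v. v \<in> S \<Longrightarrow> - v \<in> S"
begin

abbreviation w :: "nat \<Rightarrow> 'a \<Rightarrow> real" where "w \<equiv> walks S"

abbreviation reach :: "nat \<Rightarrow> 'a set" where "reach n \<equiv> {x. w n x \<noteq> 0}"

lemma finite_reach: "finite (reach n)"
proof (induction n)
  case (Suc n)
  have "reach (Suc n) \<subseteq> (\<Union>v\<in>S. (\<lambda>x. x + v) ` reach n)"
  proof
    fix x assume "x \<in> reach (Suc n)"
    then obtain v where "v \<in> S" "w n (x - v) \<noteq> 0"
      using walks_Suc_nonzeroE by blast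
    then show "x \<in> (\<Union>v\<in>S. (\<lambda>x. x + v) ` reach n)"
      by (auto intro!: bexI[of _ v] image_eqI[of _ _ "x - v"])
  qed
  then show ?case
    by (rule finite_subset) (use finite_S Suc in auto)
qed auto

lemma uminus_image_S: "uminus ` S = S"
  using uminus_S by (force simp: image_iff)

lemma sum_S_uminus: "(\<Sum>v\<in>S. f (- v)) = (\<Sum>v\<in>S. f v)"
  using sum.reindex[of uminus S f] uminus_image_S by (simp add: o_def)

lemma w_uminus: "w n (- x) = w n x"
proof (induction n arbitrary: x)
  case (Suc n)
  have "w (Suc n) (- x) = (\<Sum>v\<in>S. w n (- x - (- v)))"
    unfolding walks.simps by (rule sum_S_uminus[symmetric])
  also have "\<dots> = (\<Sum>v\<in>S. w n (- (x - v)))" by simp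
  finally show ?case by (simp only: Suc walks.simps)
qed simp

text \<open>Splits a walk at its position \<open>y\<close> after \<open>a\<close> steps. Any finite
  \<open>A\<close> containing \<open>reach a\<close> may index the sum, so that sums with different
  supports can later share an index set.\<close>

lemma w_add:
  assumes "finite A" "reach a \<subseteq> A"
  shows "w (a + b) x = (\<Sum>y\<in>A. w a y * w b (x - y))"
proof (induction b arbitrary: x)
  case 0
  have "(\<Sum>y\<in>A. w a y * w 0 (x - y)) = (\<Sum>y\<in>A. if y = x then w a y else 0)"
    by (rule sum.cong) auto
  also have "\<dots> = w a x"
    using assms by (auto simp: sum.delta)
  finally show ?case by simp
next
  case (Suc b)
  have "w (a + Suc b) x = (\<Sum>v\<in>S. \<Sum>y\<in>A. w a y * w b (x - v - y))"
    by (simp add: Suc)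
  also have "\<dots> = (\<Sum>y\<in>A. \<Sum>v\<in>S. w a y * w b (x - v - y))"
    by (rule sum.swap)
  also have "\<dots> = (\<Sum>y\<in>A. w a y * w (Suc b) (x - y))"
    by (simp add: sum_distrib_left algebra_simps)
  finally show ?case .
qed

text \<open>The inner product of two translated step counts is again a step count: substituting
  \<open>z - c\<close> reduces it to \<open>w_add\<close>, and the symmetry of \<open>S\<close>
  turns \<open>d - z\<close> into \<open>z - d\<close>.\<close>

lemma sum_w_shift:
  assumes "finite B" "(\<lambda>y. y + c) ` reach a \<subseteq> B"
  shows "(\<Sum>z\<in>B. w a (z - c) * w b (z - d)) = w (a + b) (d - c)"
proof -
  have "w (a + b) (d - c) = (\<Sum>y\<in>(\<lambda>z. z - c) ` B. w a y * w b (d - c - y))"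
  proof (rule w_add)
    show "reach a \<subseteq> (\<lambda>z. z - c) ` B"
    proof
      fix y assume "y \<in> reach a"
      then have "y + c \<in> B" using assms by blast
      then show "y \<in> (\<lambda>z. z - c) ` B" by (intro image_eqI[of _ _ "y + c"]) auto
    qed
  qed (use assms in auto)
  also have "\<dots> = (\<Sum>z\<in>B. w a (z - c) * w b (d - z))"
    by (subst sum.reindex) (auto intro: inj_onI)
  also have "\<dots> = (\<Sum>z\<in>B. w a (z - c) * w b (z - d))"
    using w_uminus[of b] by (metis minus_diff_eq)
  finally show ?thesis by simp
qed

lemma sum_w:
  assumes "finite A" "reach k \<subseteq> A"
  shows "(\<Sum>y\<in>A. w k y) = real (card S) ^ k"
  using assms
proof (induction k arbitrary: A)
  case 0
  then have "0 \<in> A" by auto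
  with 0 show ?case by (simp add: sum.delta)
next
  case (Suc k)
  have inner: "(\<Sum>y\<in>A. w k (y - v)) = real (card S) ^ k" if v: "v \<in> S" for v
  proof -
    \<comment> \<open>Appending the step \<open>v\<close> carries \<open>reach k\<close> into
      \<open>reach (Suc k)\<close>, so the translate of \<open>A\<close> still captures the whole
      mass.\<close>
    have "reach k \<subseteq> (\<lambda>y. y - v) ` A"
    proof
      fix y assume y: "y \<in> reach k"
      have "w (Suc k) (y + v) \<ge> w k (y + v - v)"
        unfolding walks.simps by (rule member_le_sum) (use v finite_S walks_nonneg in auto)
      moreover have "w k y > 0" using y walks_nonneg[of S k y] by (simp add: less_le)
      ultimately have "y + v \<in> reach (Suc k)" by simp
      then show "y \<in> (\<lambda>y. y - v) ` A"
        using Suc.prems by (intro image_eqI[of _ _ "y + v"]) auto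
    qed
    then have "(\<Sum>y\<in>(\<lambda>y. y - v) ` A. w k y) = real (card S) ^ k"
      using Suc by blast
    then show ?thesis by (subst (asm) sum.reindex) (auto intro: inj_onI)
  qed
  have "(\<Sum>y\<in>A. w (Suc k) y) = (\<Sum>v\<in>S. \<Sum>y\<in>A. w k (y - v))"
    unfolding walks.simps by (rule sum.swap)
  also have "\<dots> = real (card S) ^ Suc k" using inner by simp
  finally show ?case .
qed

section \<open>Return counts and Cauchy-Schwarz\<close>

abbreviation u :: "nat \<Rightarrow> real" where "u k \<equiv> w (2 * k) 0"

text \<open>With \<open>g\<close> the \<open>k\<close>-step counts, \<open>2 (u k - w (2 * k) d)\<close> is the squared \<open>\<ell>\<^sup>2\<close>-distance between
  \<open>g\<close> and its translate by \<open>d\<close>.\<close>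
lemma w_even_le_u: "w (2 * k) d \<le> u k"
  and u_minus_w_triangle: "u k - w (2 * k) (x + y) \<le> 2 * (u k - w (2 * k) x) + 2 * (u k - w (2 * k) y)"
proof -
  define sh where "sh c = (\<lambda>y. y + c) ` reach k" for c
  have ip: "(\<Sum>z\<in>B. w k (z - c) * w k (z - d)) = w (2 * k) (d - c)"
    if "finite B" "sh c \<subseteq> B" for B c d
    using sum_w_shift[of B c k k d] that by (simp add: sh_def mult_2)
  have sq: "(\<Sum>z\<in>B. (w k (z - c) - w k (z - d))\<^sup>2) = 2 * (u k - w (2 * k) (d - c))"
    if "finite B" "sh c \<subseteq> B" "sh d \<subseteq> B" for B c d
  proof -
    have "(\<Sum>z\<in>B. (w k (z - c) - w k (z - d))\<^sup>2) =
        (\<Sum>z\<in>B. w k (z - c) * w k (z - c)) + (\<Sum>z\<in>B. w k (z - d) * w k (z - d))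
        - 2 * (\<Sum>z\<in>B. w k (z - c) * w k (z - d))"
      by (simp add: power2_eq_square algebra_simps sum.distrib sum_subtractf sum_distrib_left)
    then show ?thesis using ip that by simp
  qed
  have fin: "finite (sh c)" for c by (simp add: sh_def finite_reach)
  have "0 \<le> (\<Sum>z\<in>sh 0 \<union> sh d. (w k (z - 0) - w k (z - d))\<^sup>2)"
    by (intro sum_nonneg) auto
  then show "w (2 * k) d \<le> u k" using sq[of "sh 0 \<union> sh d" 0 d] fin by auto
  \<comment> \<open>One index set containing all three translates, so that the three distances are
    sums over the same points.\<close>
  define B where "B = sh 0 \<union> sh x \<union> sh (x + y)"
  have B: "finite B" "sh 0 \<subseteq> B" "sh x \<subseteq> B" "sh (x + y) \<subseteq> B"
    using fin by (auto simp: B_def)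
  \<comment> \<open>Squares satisfy the triangle inequality only up to the factor 2; the gap is the
    square of \<open>(a - b) - (b - c)\<close>.\<close>
  have pt: "(a - c)\<^sup>2 \<le> 2 * (a - b)\<^sup>2 + 2 * (b - c)\<^sup>2" for a b c :: real
    using zero_le_power2[of "(a - b) - (b - c)"] by (simp add: power2_eq_square algebra_simps)
  have "(\<Sum>z\<in>B. (w k (z - 0) - w k (z - (x + y)))\<^sup>2)
      \<le> (\<Sum>z\<in>B. 2 * (w k (z - 0) - w k (z - x))\<^sup>2 + 2 * (w k (z - x) - w k (z - (x + y)))\<^sup>2)"
    by (intro sum_mono pt)
  also have "\<dots> = 2 * (\<Sum>z\<in>B. (w k (z - 0) - w k (z - x))\<^sup>2)
      + 2 * (\<Sum>z\<in>B. (w k (z - x) - w k (z - (x + y)))\<^sup>2)"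
    by (simp add: sum.distrib sum_distrib_left)
  finally show "u k - w (2 * k) (x + y) \<le> 2 * (u k - w (2 * k) x) + 2 * (u k - w (2 * k) y)"
    using sq[of B 0 "x + y"] sq[of B 0 x] sq[of B x "x + y"] B by simp
qed

lemma u_Suc: "u (Suc k) = (\<Sum>v\<in>S. \<Sum>v'\<in>S. w (2 * k) (- v - v'))"
  by simp

lemma u_Suc_le: "u (Suc k) \<le> (real (card S))\<^sup>2 * u k"
proof -
  have "u (Suc k) \<le> (\<Sum>v\<in>S. \<Sum>v'\<in>S. u k)"
    unfolding u_Suc by (intro sum_mono w_even_le_u)
  then show ?thesis by (simp add: power2_eq_square)
qed

text \<open>Cauchy-Schwarz for \<open>w k\<close> and \<open>w (k + 2)\<close>: their inner product
  is \<open>u (k + 1)\<close>, and their squared norms are \<open>u k\<close> and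
  \<open>u (k + 2)\<close>.\<close>

lemma u_log_convex: "(u (Suc k))\<^sup>2 \<le> u k * u (Suc (Suc k))"
proof -
  define B where "B = reach k \<union> reach (Suc (Suc k))"
  have ip: "(\<Sum>z\<in>B. w a z * w b z) = w (a + b) 0" if "reach a \<subseteq> B" for a b
    using sum_w_shift[of B 0 a b 0] that finite_reach unfolding B_def by (simp del: walks.simps)
  have "(\<Sum>z\<in>B. w k z * w (Suc (Suc k)) z)\<^sup>2
      \<le> (\<Sum>z\<in>B. (w k z)\<^sup>2) * (\<Sum>z\<in>B. (w (Suc (Suc k)) z)\<^sup>2)"
    by (rule Cauchy_Schwarz_ineq_sum)
  moreover have "k + Suc (Suc k) = 2 * Suc k" "k + k = 2 * k"
    "Suc (Suc k) + Suc (Suc k) = 2 * Suc (Suc k)" by auto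
  moreover have "reach k \<subseteq> B" "reach (Suc (Suc k)) \<subseteq> B" by (auto simp: B_def)
  ultimately show ?thesis
    by (simp only: power2_eq_square[of "w _ _"] ip)
qed

text \<open>Cauchy-Schwarz for \<open>w k\<close> against the constant 1 on \<open>reach k\<close>,
  where \<open>w k\<close> has total mass \<open>card S ^ k\<close> and squared norm
  \<open>u k\<close>.\<close>

lemma card_power_le_reach: "(real (card S))\<^sup>2 ^ k \<le> real (card (reach k)) * u k"
proof -
  have "(real (card S) ^ k)\<^sup>2 = (\<Sum>z\<in>reach k. 1 * w k z)\<^sup>2"
    using sum_w[of "reach k" k] finite_reach by simp
  also have "\<dots> \<le> (\<Sum>z\<in>reach k. 1\<^sup>2) * (\<Sum>z\<in>reach k. (w k z)\<^sup>2)"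
    by (rule Cauchy_Schwarz_ineq_sum)
  also have "(\<Sum>z\<in>reach k. (w k z)\<^sup>2) = u k"
    using sum_w_shift[of "reach k" 0 k k 0] finite_reach by (simp add: power2_eq_square mult_2)
  finally show ?thesis by (simp add: power_even_eq power_mult[symmetric] mult.commute)
qed

lemma card_S_pos: "real (card S) > 0"
  using finite_S S_nonempty by (simp add: card_gt_0_iff)

lemma u_pos: "u k > 0"
proof -
  have "0 < real (card (reach k)) * u k"
    by (rule less_le_trans[OF _ card_power_le_reach]) (use card_S_pos in simp)
  then show ?thesis by (simp add: zero_less_mult_iff)
qed

end

section \<open>Ratio limits under polynomial growth\<close>

locale polynomial_growth = symmetric_steps +
  fixes d :: nat
  assumes card_reach_le: "card {x. walks S k x \<noteq> 0} \<le> (2 * k + 1) ^ d"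
begin

lemma u_ratio_tendsto: "(\<lambda>k. u (Suc k) / u k) \<longlonglongrightarrow> (real (card S))\<^sup>2"
proof -
  define r where "r k = u (Suc k) / u k" for k
  define N where "N = (real (card S))\<^sup>2"
  have Npos: "N > 0" using card_S_pos by (simp add: N_def)
  have rpos: "r k > 0" for k unfolding r_def by (intro divide_pos_pos u_pos)
  have rN: "r k \<le> N" for k
    unfolding r_def N_def using u_Suc_le[of k] u_pos[of k] by (subst pos_divide_le_eq) 
  have "r k \<le> r (Suc k)" for k
    using u_log_convex[of k] u_pos[of k] u_pos[of "Suc k"]
    unfolding r_def power2_eq_square by (subst frac_le_eq) (auto simp: divide_simps mult.commute)
  then have inc: "incseq r" by (rule incseq_SucI)
  then obtain L where L: "r \<longlonglongrightarrow> L" "\<And>k. r k \<le> L"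
    using incseq_convergent[OF inc, of N] rN by blast
  have LN: "L \<le> N" using LIMSEQ_le_const2[OF L(1)] rN by blast
  have Lpos: "L > 0" using rpos[of 0] L(2)[of 0] by simp
  \<comment> \<open>Every ratio is at most \<open>L\<close> and \<open>u 0 = 1\<close>, so the
    product of ratios telescopes.\<close>
  have uL: "u k \<le> L ^ k" for k
  proof (induction k)
    case (Suc k)
    have "u (Suc k) = r k * u k" using u_pos[of k] by (simp add: r_def)
    also have "\<dots> \<le> L * L ^ k"
      using Suc L(2) u_pos[of k] Lpos by (intro mult_mono) auto
    finally show ?case by simp
  qed simp
  have "\<not> L < N"
  proof
    assume less: "L < N"
    define q where "q = L / N"
    have q: "0 < q" "q < 1" using less Lpos Npos by (auto simp: q_def)
    \<comment> \<open>The lower bound \<open>card_power_le_reach\<close> divided by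
      \<open>N ^ k\<close>; geometric decay of \<open>q ^ k\<close> beats the polynomial factor,
      which is the contradiction.\<close>
    have "1 \<le> (2 * real k + 1) ^ d * q ^ k" for k
    proof -
      have "N ^ k \<le> real (card (reach k)) * u k" using card_power_le_reach[of k] by (simp add: N_def)
      also have "\<dots> \<le> real ((2 * k + 1) ^ d) * L ^ k"
        using card_reach_le[of k] uL u_pos[of k] by (intro mult_mono) (auto simp del: of_nat_power)
      finally show ?thesis using Npos by (simp add: q_def power_divide field_simps)
    qed
    moreover have "(\<lambda>k. (2 * real k + 1) ^ d * q ^ k) \<longlonglongrightarrow> 0"
      using q by real_asymp
    ultimately show False
      using LIMSEQ_le_const[of "\<lambda>k. (2 * real k + 1) ^ d * q ^ k" 0 1] by auto
  qed
  with LN L(1) show ?thesis by (simp add: r_def[abs_def] N_def)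
qed

text \<open>By symmetry of \<open>S\<close> this monoid is a group.\<close>
inductive_set even_span :: "'a set" where
  zero: "0 \<in> even_span"
| step: "x \<in> even_span \<Longrightarrow> v \<in> S \<Longrightarrow> v' \<in> S \<Longrightarrow> x + (v + v') \<in> even_span"

lemma w_ratio_tendsto_step:
  assumes "v \<in> S" "v' \<in> S"
  shows "(\<lambda>k. (u k - w (2 * k) (v + v')) / u k) \<longlonglongrightarrow> 0"
proof (rule tendsto_sandwich[OF _ _ tendsto_const])
  show "(\<lambda>k. (real (card S))\<^sup>2 - u (Suc k) / u k) \<longlonglongrightarrow> 0"
    using tendsto_diff[OF tendsto_const u_ratio_tendsto, of "(real (card S))\<^sup>2"] by simp
  show "\<forall>\<^sub>F k in sequentially. 0 \<le> (u k - w (2 * k) (v + v')) / u k"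
    using w_even_le_u u_pos by (intro always_eventually allI divide_nonneg_pos) auto
  show "\<forall>\<^sub>F k in sequentially. (u k - w (2 * k) (v + v')) / u k \<le> (real (card S))\<^sup>2 - u (Suc k) / u k"
  proof (intro always_eventually allI)
    fix k
    \<comment> \<open>The sign matches the terms of \<open>u_Suc\<close>; \<open>w_uminus\<close>
      converts back to \<open>v + v'\<close>. One deficit is at most the sum of all of them, since
      none is negative.\<close>
    define D where "D a b = u k - w (2 * k) (- a - b)" for a b
    have D0: "D a b \<ge> 0" for a b using w_even_le_u by (simp add: D_def)
    have "- (v + v') = - v - v'" by simp
    then have "u k - w (2 * k) (v + v') = D v v'"
      unfolding D_def using w_uminus[of "2 * k" "v + v'"] by simp
    also have "\<dots> \<le> (\<Sum>b\<in>S. D v b)"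
      by (rule member_le_sum) (use assms D0 finite_S in auto)
    also have "\<dots> \<le> (\<Sum>a\<in>S. \<Sum>b\<in>S. D a b)"
      by (rule member_le_sum) (use assms D0 finite_S in \<open>auto intro: sum_nonneg\<close>)
    also have "\<dots> = (real (card S))\<^sup>2 * u k - u (Suc k)"
      unfolding u_Suc D_def by (simp add: sum_subtractf power2_eq_square)
    finally have "(u k - w (2 * k) (v + v')) / u k \<le> ((real (card S))\<^sup>2 * u k - u (Suc k)) / u k"
      using u_pos[of k] by (intro divide_right_mono) auto
    then show "(u k - w (2 * k) (v + v')) / u k \<le> (real (card S))\<^sup>2 - u (Suc k) / u k"
      using u_pos[of k] by (simp only: diff_divide_distrib) simp
  qed
qed

text \<open>Induction along \<open>even_span\<close>, with \<open>u_minus_w_triangle\<close>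
  bounding each new deficit. The factors 2 accumulate, but their number depends on \<open>x\<close>
  only and not on \<open>k\<close>.\<close>

lemma w_ratio_tendsto:
  assumes "x \<in> even_span"
  shows "(\<lambda>k. w (2 * k) x / u k) \<longlonglongrightarrow> 1"
proof -
  have "(\<lambda>k. (u k - w (2 * k) x) / u k) \<longlonglongrightarrow> 0"
    using assms
  proof induction
    case (step x v v')
    let ?D = "\<lambda>y k. (u k - w (2 * k) y) / u k"
    show ?case
    proof (rule tendsto_sandwich[OF _ _ tendsto_const])
      show "(\<lambda>k. 2 * ?D x k + 2 * ?D (v + v') k) \<longlonglongrightarrow> 0"
        using tendsto_add[OF tendsto_mult_left[OF step.IH, of 2]
            tendsto_mult_left[OF w_ratio_tendsto_step[OF step.hyps(2,3)], of 2]] by simp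
      show "\<forall>\<^sub>F k in sequentially. 0 \<le> ?D (x + (v + v')) k"
        using w_even_le_u u_pos by (intro always_eventually allI divide_nonneg_pos) auto
      show "\<forall>\<^sub>F k in sequentially. ?D (x + (v + v')) k \<le> 2 * ?D x k + 2 * ?D (v + v') k"
      proof (intro always_eventually allI)
        fix k
        show "?D (x + (v + v')) k \<le> 2 * ?D x k + 2 * ?D (v + v') k"
          using divide_right_mono[OF u_minus_w_triangle[of k x "v + v'"], of "u k"] u_pos[of k]
          by (simp only: add_divide_distrib times_divide_eq_right less_imp_le)
      qed
    qed
  qed simp
  then have "(\<lambda>k. 1 - (u k - w (2 * k) x) / u k) \<longlonglongrightarrow> 1 - 0"
    by (intro tendsto_diff tendsto_const)
  moreover have "1 - (u k - w (2 * k) x) / u k = w (2 * k) x / u k" for k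
    using u_pos[of k] by (simp add: divide_simps)
  ultimately show ?thesis by simp
qed

text \<open>Removing the last step leaves an even walk to \<open>e - v\<close>, a point of
  \<open>even_span\<close>, so each of the \<open>card E * card S\<close> terms is asymptotic to
  \<open>u k\<close>.\<close>

lemma odd_ratio_tendsto:
  assumes "finite E" "E \<noteq> {}" "\<And>e v. e \<in> E \<Longrightarrow> v \<in> S \<Longrightarrow> e - v \<in> even_span"
  shows "(\<lambda>k. (\<Sum>e\<in>E. w (2 * Suc k + 1) e) / (\<Sum>e\<in>E. w (2 * k + 1) e)) \<longlonglongrightarrow> (real (card S))\<^sup>2"
proof -
  define a where "a k = (\<Sum>e\<in>E. w (2 * k + 1) e)" for k
  define C where "C = real (card E) * real (card S)"
  have C: "C \<noteq> 0" using assms card_S_pos by (simp add: C_def)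
  have a: "a k / u k = (\<Sum>e\<in>E. \<Sum>v\<in>S. w (2 * k) (e - v) / u k)" for k
    by (simp add: a_def sum_divide_distrib)
  have lim: "(\<lambda>k. a k / u k) \<longlonglongrightarrow> C"
  proof -
    have "(\<lambda>k. a k / u k) \<longlonglongrightarrow> (\<Sum>e\<in>E. \<Sum>v\<in>S. 1)"
      unfolding a by (intro tendsto_sum w_ratio_tendsto assms(3))
    then show ?thesis by (simp add: C_def)
  qed
  \<comment> \<open>The constant \<open>C\<close> cancels between consecutive terms, leaving the
    limit of \<open>u (Suc k) / u k\<close>.\<close>
  have "(\<lambda>k. (a (Suc k) / u (Suc k)) * (u (Suc k) / u k) / (a k / u k)) \<longlonglongrightarrow> C * (real (card S))\<^sup>2 / C"
    by (intro tendsto_divide tendsto_mult LIMSEQ_Suc[OF lim] lim u_ratio_tendsto C)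
  moreover have "(a (Suc k) / u (Suc k)) * (u (Suc k) / u k) / (a k / u k) = a (Suc k) / a k" for k
    using u_pos[of k] u_pos[of "Suc k"] by (simp del: walks.simps mult_Suc_right)
  moreover have "C * (real (card S))\<^sup>2 / C = (real (card S))\<^sup>2" using C by simp
  ultimately have "(\<lambda>k. a (Suc k) / a k) \<longlonglongrightarrow> (real (card S))\<^sup>2"
    by (simp only:)
  then show ?thesis by (simp only: a_def)
qed

end

section \<open>Balanced columns\<close>

text \<open>Columns are functions that vanish from \<open>m\<close> on, so that pointwise operations
  supply the abelian group and each column has a unique representation.\<close>

definition balanced_columns :: "nat \<Rightarrow> (nat \<Rightarrow> int) set" where
  "balanced_columns m =
    {v. (\<forall>i<m. v i \<in> {1, -1}) \<and> (\<forall>i\<ge>m. v i = 0) \<and> \<bar>\<Sum>i<m. v i\<bar> \<le> 1}"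

text \<open>Radius 1 expresses the row condition on matrices; radius \<open>k\<close> contains every
  endpoint of a \<open>k\<close>-step walk.\<close>

definition cube :: "nat \<Rightarrow> nat \<Rightarrow> (nat \<Rightarrow> int) set" where
  "cube m r = {x. (\<forall>i<m. \<bar>x i\<bar> \<le> int r) \<and> (\<forall>i\<ge>m. x i = 0)}"

lemma finite_cube: "finite (cube m r)"
  and card_cube_le: "card (cube m r) \<le> (2 * r + 1) ^ m"
proof -
  let ?P = "\<Pi>\<^sub>E i\<in>{..<m}. {- int r..int r}"
  have inj: "inj_on (\<lambda>x. restrict x {..<m}) (cube m r)"
  proof (rule inj_onI, rule ext)
    fix x y i
    assume xy: "x \<in> cube m r" "y \<in> cube m r" and eq: "restrict x {..<m} = restrict y {..<m}"
    show "x i = y i"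
      using xy fun_cong[OF eq, of i] by (cases "i < m") (auto simp: cube_def)
  qed
  have sub: "(\<lambda>x. restrict x {..<m}) ` cube m r \<subseteq> ?P"
    by (intro image_subsetI PiE_I) (auto simp: cube_def abs_le_iff minus_le_iff)
  have fin: "finite ?P" by (intro finite_PiE) auto
  show "finite (cube m r)"
    using finite_subset[OF sub fin] inj by (rule finite_imageD)
  have "card (cube m r) \<le> card ?P"
    using inj sub fin by (rule card_inj_on_le)
  also have "\<dots> = (2 * r + 1) ^ m" by (simp add: card_PiE nat_add_distrib nat_mult_distrib)
  finally show "card (cube m r) \<le> (2 * r + 1) ^ m" .
qed

lemma balanced_columns_subset_cube: "balanced_columns m \<subseteq> cube m 1"
  by (auto simp: balanced_columns_def cube_def)

lemma finite_balanced_columns: "finite (balanced_columns m)"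
  using balanced_columns_subset_cube finite_cube by (rule finite_subset)

section \<open>Matrices as walks\<close>

lemma sum_list_fun_apply: "sum_list xs i = (\<Sum>j<length xs. (xs ! j) i)"
  for xs :: "('a \<Rightarrow> 'b::comm_monoid_add) list"
  by (induction xs rule: rev_induct) (auto simp: nth_append)

text \<open>A matrix corresponds to the list of its columns; its row sums are then the coordinates
  of the sum of the list.\<close>

lemma alpha_eq_card_lists:
  "alpha m n = card {xs. length xs = n \<and> set xs \<subseteq> balanced_columns m \<and> sum_list xs \<in> cube m 1}"
proof -
  let ?L = "{xs. length xs = n \<and> set xs \<subseteq> balanced_columns m \<and> sum_list xs \<in> cube m 1}"
  let ?f = "\<lambda>xs. Matrix.mat m n (\<lambda>(i, j). (xs ! j) i) :: int mat"
  let ?g = "\<lambda>M :: int mat. map (\<lambda>j i. if i < m then M $$ (i, j) else 0) [0..<n]"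
  have "bij_betw ?f ?L (balanced_mats m n)"
  proof (rule bij_betw_byWitness[where f' = ?g])
    show "\<forall>xs\<in>?L. ?g (?f xs) = xs"
    proof
      fix xs assume xs: "xs \<in> ?L"
      show "?g (?f xs) = xs"
      proof (rule nth_equalityI)
        fix j assume "j < length (?g (?f xs))"
        then have j: "j < n" by simp
        then have "xs ! j \<in> balanced_columns m" using xs nth_mem by blast
        then show "?g (?f xs) ! j = xs ! j"
          using j by (auto simp: balanced_columns_def)
      qed (use xs in simp)
    qed
    show "\<forall>M\<in>balanced_mats m n. ?f (?g M) = M"
      by (auto simp: balanced_mats_def)
    show "?f ` ?L \<subseteq> balanced_mats m n"
    proof (rule image_subsetI)
      fix xs assume xs: "xs \<in> ?L"
      have col: "xs ! j \<in> balanced_columns m" if "j < n" for j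
        using xs that nth_mem by blast
      have row: "(\<Sum>j<n. (xs ! j) i) = sum_list xs i" for i
        using xs by (simp add: sum_list_fun_apply)
      have "(xs ! j) i = 1 \<or> (xs ! j) i = -1" if "i < m" "j < n" for i j
        using col[OF that(2)] that(1) by (auto simp: balanced_columns_def)
      moreover have "\<bar>\<Sum>i<m. (xs ! j) i\<bar> \<le> 1" if "j < n" for j
        using col[OF that] by (simp add: balanced_columns_def)
      moreover have "\<bar>\<Sum>j<n. (xs ! j) i\<bar> \<le> 1" if "i < m" for i
        using xs that unfolding row by (simp add: cube_def)
      ultimately show "?f xs \<in> balanced_mats m n"
        by (simp add: balanced_mats_def)
    qed
    show "?g ` balanced_mats m n \<subseteq> ?L"
    proof (rule image_subsetI)
      fix M assume M: "M \<in> balanced_mats m n"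
      have "(\<lambda>i. if i < m then M $$ (i, j) else 0) \<in> balanced_columns m" if "j < n" for j
        using M that unfolding balanced_mats_def balanced_columns_def by simp
      moreover have "sum_list (?g M) \<in> cube m 1"
        using M by (simp add: balanced_mats_def cube_def sum_list_fun_apply)
      ultimately show "?g M \<in> ?L" by auto
    qed
  qed
  then show ?thesis unfolding alpha_def by (rule bij_betw_same_card[symmetric])
qed

lemma alpha_eq_sum_walks: "real (alpha m n) = (\<Sum>e\<in>cube m 1. walks (balanced_columns m) n e)"
proof -
  let ?S = "balanced_columns m"
  let ?L = "\<lambda>e. {xs. length xs = n \<and> set xs \<subseteq> ?S \<and> sum_list xs = e}"
  have fin: "finite (?L e)" for e
    by (rule finite_subset[OF _ finite_lists_length_eq[OF finite_balanced_columns, of m n]]) auto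
  have "{xs. length xs = n \<and> set xs \<subseteq> ?S \<and> sum_list xs \<in> cube m 1} = (\<Union>e\<in>cube m 1. ?L e)"
    by auto
  moreover have "card (\<Union>e\<in>cube m 1. ?L e) = (\<Sum>e\<in>cube m 1. card (?L e))"
    by (rule card_UN_disjoint) (use fin finite_cube in auto)
  ultimately show ?thesis
    by (simp add: alpha_eq_card_lists walks_eq_card[OF finite_balanced_columns])
qed

section \<open>Parity constraints\<close>

lemma even_sum_odd_terms:
  fixes v :: "'a \<Rightarrow> int"
  assumes "finite A" "\<And>i. i \<in> A \<Longrightarrow> odd (v i)"
  shows "even (\<Sum>i\<in>A. v i) \<longleftrightarrow> even (card A)"
  using assms by (induction A rule: finite_induct) auto

lemma sum_balanced_column_eq_0:
  assumes "v \<in> balanced_columns m" "even m"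
  shows "(\<Sum>i<m. v i) = 0"
proof -
  have "even (\<Sum>i<m. v i) \<longleftrightarrow> even (card {..<m})"
    by (rule even_sum_odd_terms) (use assms in \<open>auto simp: balanced_columns_def\<close>)
  then have "even (\<Sum>i<m. v i)" using assms by simp
  moreover have "\<bar>\<Sum>i<m. v i\<bar> \<le> 1" using assms by (simp add: balanced_columns_def)
  ultimately show ?thesis by presburger
qed

text \<open>Each step changes every coordinate below \<open>m\<close> by 1 or -1, hence flips its
  parity; for even \<open>m\<close> each step also has coordinate sum 0. These invariants give both
  the growth bound and the possible endpoints.\<close>

lemma walks_support:
  assumes "walks (balanced_columns m) n x \<noteq> 0"
  shows "x \<in> cube m n \<and> (\<forall>i<m. even (x i) \<longleftrightarrow> even n) \<and> (even m \<longrightarrow> (\<Sum>i<m. x i) = 0)"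
  using assms
proof (induction n arbitrary: x)
  case 0
  then show ?case by (auto simp: cube_def split: if_splits)
next
  case (Suc n)
  then obtain v where v: "v \<in> balanced_columns m" "walks (balanced_columns m) n (x - v) \<noteq> 0"
    using walks_Suc_nonzeroE by blast
  note xv = Suc.IH[OF v(2)]
  have IH: "x - v \<in> cube m n" "\<And>i. i < m \<Longrightarrow> even (x i - v i) \<longleftrightarrow> even n"
    using xv by (blast, simp)
  have sum_eq: "even m \<Longrightarrow> (\<Sum>i<m. x i) = (\<Sum>i<m. v i)"
    using xv by (simp add: sum_subtractf)
  have v1: "v i = 1 \<or> v i = -1" if "i < m" for i
    using v(1) that by (auto simp: balanced_columns_def)
  have "even (x i) \<longleftrightarrow> even (Suc n)" if "i < m" for i
    using IH(2)[OF that] v1[OF that] by auto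
  moreover have "\<bar>x i\<bar> \<le> int (Suc n)" if "i < m" for i
  proof -
    have "\<bar>x i - v i\<bar> \<le> int n" using IH(1) that by (simp add: cube_def)
    then show ?thesis using v1[OF that] by auto
  qed
  moreover have "x i = 0" if "i \<ge> m" for i
  proof -
    have "x i - v i = 0" using IH(1) that by (simp add: cube_def)
    then show ?thesis using v(1) that by (simp add: balanced_columns_def)
  qed
  moreover have "even m \<Longrightarrow> (\<Sum>i<m. x i) = 0"
    using sum_eq sum_balanced_column_eq_0[OF v(1)] by simp
  ultimately show ?case by (simp add: cube_def)
qed

section \<open>Counting balanced columns\<close>

definition sign_vector :: "nat \<Rightarrow> nat set \<Rightarrow> nat \<Rightarrow> int" where
  "sign_vector m T i = (if i < m then if i \<in> T then 1 else -1 else 0)"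

lemma sum_sign_vector:
  assumes "T \<subseteq> {..<m}"
  shows "(\<Sum>i<m. sign_vector m T i) = 2 * int (card T) - int m"
proof -
  have "(\<Sum>i<m. sign_vector m T i) = (\<Sum>i<m. 2 * (if i \<in> T then 1 else 0) - 1)"
    by (rule sum.cong) (auto simp: sign_vector_def)
  also have "\<dots> = 2 * (\<Sum>i<m. if i \<in> T then 1 else 0) - int m"
    by (simp add: sum_subtractf sum_distrib_left)
  also have "(\<Sum>i<m. if i \<in> T then 1 else 0) = int (card T)"
    using assms by (simp add: sum.If_cases Int_absorb1)
  finally show ?thesis .
qed

lemma sign_vector_mem_balanced_columns_iff:
  assumes "T \<subseteq> {..<m}"
  shows "sign_vector m T \<in> balanced_columns m \<longleftrightarrow> \<bar>2 * int (card T) - int m\<bar> \<le> 1"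
  using sum_sign_vector[OF assms] by (auto simp: balanced_columns_def sign_vector_def)

text \<open>A column is determined by its set of positive entries. For \<open>m = 2 * k\<close> this
  set has size \<open>k\<close>; for \<open>m = 2 * k + 1\<close> it has size \<open>k\<close> or
  \<open>k + 1\<close>, and Pascal's rule merges the two binomials.\<close>

lemma card_balanced_columns:
  "card (balanced_columns m) = (2 * ((m + 1) div 2)) choose ((m + 1) div 2)"
proof -
  let ?P = "\<lambda>j. {T. T \<subseteq> {..<m} \<and> card T = j}"
  let ?T = "{T. T \<subseteq> {..<m} \<and> \<bar>2 * int (card T) - int m\<bar> \<le> 1}"
  have "bij_betw (sign_vector m) ?T (balanced_columns m)"
  proof (rule bij_betw_byWitness[where f' = "\<lambda>v. {i. i < m \<and> v i = 1}"])
    show "\<forall>T\<in>?T. {i. i < m \<and> sign_vector m T i = 1} = T"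
      by (auto simp: sign_vector_def split: if_splits)
    show *: "\<forall>v\<in>balanced_columns m. sign_vector m {i. i < m \<and> v i = 1} = v"
      by (auto simp: sign_vector_def balanced_columns_def fun_eq_iff)
    show "sign_vector m ` ?T \<subseteq> balanced_columns m"
      using sign_vector_mem_balanced_columns_iff by blast
    show "(\<lambda>v. {i. i < m \<and> v i = 1}) ` balanced_columns m \<subseteq> ?T"
    proof (rule image_subsetI)
      fix v assume v: "v \<in> balanced_columns m"
      have "{i. i < m \<and> v i = 1} \<subseteq> {..<m}" by auto
      then show "{i. i < m \<and> v i = 1} \<in> ?T"
        using sign_vector_mem_balanced_columns_iff[of "{i. i < m \<and> v i = 1}" m] * v by simp
    qed
  qed
  then have card: "card (balanced_columns m) = card ?T" by (rule bij_betw_same_card[symmetric])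
  show ?thesis
  proof (cases "even m")
    case True
    then obtain k where k: "m = 2 * k" by (elim evenE)
    have "?T = ?P k" unfolding k by auto
    then show ?thesis using n_subsets[of "{..<m}" k] card k by simp
  next
    case False
    then obtain k where k: "m = 2 * k + 1" by (elim oddE)
    have "?T = ?P k \<union> ?P (Suc k)" unfolding k by auto
    moreover have "card (?P k \<union> ?P (Suc k)) = card (?P k) + card (?P (Suc k))"
      by (rule card_Un_disjoint) auto
    moreover have "(2 * Suc k) choose Suc k = (m choose k) + (m choose Suc k)"
      using k by simp
    ultimately show ?thesis
      using n_subsets[of "{..<m}"] card k by simp
  qed
qed

lemma balanced_columns_nonempty: "balanced_columns m \<noteq> {}"
proof -
  have "card (balanced_columns m) > 0"
    unfolding card_balanced_columns by (simp add: zero_less_binomial)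
  then show ?thesis by auto
qed

text \<open>The growth exponent is \<open>m\<close>, because \<open>k\<close> steps stay inside
  \<open>cube m k\<close>.\<close>

interpretation balanced_walks: polynomial_growth "balanced_columns m" m for m
proof
  show "finite (balanced_columns m)" by (rule finite_balanced_columns)
  show "balanced_columns m \<noteq> {}" by (rule balanced_columns_nonempty)
  show "- v \<in> balanced_columns m" if "v \<in> balanced_columns m" for v
    using that by (auto simp: balanced_columns_def sum_negf)
  show "card {x. walks (balanced_columns m) k x \<noteq> 0} \<le> (2 * k + 1) ^ m" for k
  proof -
    have "{x. walks (balanced_columns m) k x \<noteq> 0} \<subseteq> cube m k"
      using walks_support by blast
    then show ?thesis
      using card_mono[OF finite_cube] card_cube_le le_trans by blast
  qed
qed

section \<open>Endpoints of even and odd length\<close>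

lemma walks_even_eq_0:
  assumes "e \<in> cube m 1" "e \<noteq> 0"
  shows "walks (balanced_columns m) (2 * k) e = 0"
proof (rule ccontr)
  assume "walks (balanced_columns m) (2 * k) e \<noteq> 0"
  then have ev: "even (e i)" if "i < m" for i using walks_support that by fastforce
  have "e i = 0" for i
  proof (cases "i < m")
    case True
    then have "\<bar>e i\<bar> \<le> 1" using assms(1) by (simp add: cube_def)
    with ev[OF True] show ?thesis by presburger
  qed (use assms(1) in \<open>simp add: cube_def\<close>)
  then show False using assms(2) by (simp add: fun_eq_iff)
qed

lemma alpha_even: "real (alpha m (2 * k)) = walks (balanced_columns m) (2 * k) 0"
proof -
  have "0 \<in> cube m 1" by (simp add: cube_def)
  moreover have "(\<Sum>e\<in>cube m 1 - {0}. walks (balanced_columns m) (2 * k) e) = 0"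
    by (intro sum.neutral) (use walks_even_eq_0 in auto)
  ultimately show ?thesis
    unfolding alpha_eq_sum_walks by (simp add: sum.remove[OF finite_cube])
qed

text \<open>For even \<open>m\<close> these are exactly the balanced columns; for odd
  \<open>m\<close> they are all sign vectors, whatever their sum.\<close>

definition odd_endpoints :: "nat \<Rightarrow> (nat \<Rightarrow> int) set" where
  "odd_endpoints m =
    {e \<in> cube m 1. (\<forall>i<m. odd (e i)) \<and> (even m \<longrightarrow> (\<Sum>i<m. e i) = 0)}"

lemma alpha_odd:
  "real (alpha m (2 * k + 1)) = (\<Sum>e\<in>odd_endpoints m. walks (balanced_columns m) (2 * k + 1) e)"
  unfolding alpha_eq_sum_walks
proof (rule sum.mono_neutral_right[OF finite_cube])
  show "odd_endpoints m \<subseteq> cube m 1" by (auto simp: odd_endpoints_def)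
  show "\<forall>e\<in>cube m 1 - odd_endpoints m. walks (balanced_columns m) (2 * k + 1) e = 0"
  proof
    fix e assume "e \<in> cube m 1 - odd_endpoints m"
    then show "walks (balanced_columns m) (2 * k + 1) e = 0"
      using walks_support[of m "2 * k + 1" e] unfolding odd_endpoints_def by auto
  qed
qed

lemma odd_endpoints_eq_sign:
  assumes "e \<in> odd_endpoints m" "i < m"
  shows "e i = 1 \<or> e i = -1"
proof -
  have "\<bar>e i\<bar> \<le> 1" "odd (e i)" using assms by (auto simp: odd_endpoints_def cube_def)
  then show ?thesis by presburger
qed

lemma odd_endpoints_even:
  assumes "even m" shows "odd_endpoints m \<subseteq> balanced_columns m"
  using assms odd_endpoints_eq_sign
  by (auto simp: balanced_columns_def odd_endpoints_def cube_def)

lemma balanced_columns_subset_odd_endpoints: "balanced_columns m \<subseteq> odd_endpoints m"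
proof
  fix v assume v: "v \<in> balanced_columns m"
  then have "odd (v i)" if "i < m" for i using that by (auto simp: balanced_columns_def)
  then show "v \<in> odd_endpoints m"
    using v balanced_columns_subset_cube sum_balanced_column_eq_0[OF v]
    by (auto simp: odd_endpoints_def)
qed

text \<open>With \<open>m = 2 * k + 1\<close> and a set \<open>T\<close> of size \<open>k\<close>
  avoiding \<open>j\<close>, the sign vectors of \<open>insert j T\<close> and \<open>T\<close> have
  sums 1 and -1, so both are balanced, and they differ by 2 exactly at \<open>j\<close>. Swapping
  them gives -2.\<close>

lemma double_unit_eq_sum_balanced:
  assumes "odd m" "j < m" "c \<in> {2, -2}"
  obtains v v' where "v \<in> balanced_columns m" "v' \<in> balanced_columns m"
    "(\<lambda>i. if i = j then c else 0) = v + v'"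
proof -
  obtain k where k: "m = 2 * k + 1" using assms(1) by (elim oddE)
  have "k \<le> card ({..<m} - {j})" using assms(2) k by simp
  then obtain T where T: "T \<subseteq> {..<m} - {j}" "card T = k"
    using obtain_subset_with_card_n by metis
  have fin: "finite T" using T(1) finite_subset by blast
  have jT: "j \<notin> T" using T(1) by auto
  have sub: "T \<subseteq> {..<m}" "insert j T \<subseteq> {..<m}" using T(1) assms(2) by auto
  let ?v = "sign_vector m (insert j T)" and ?v' = "sign_vector m T"
  have v: "?v \<in> balanced_columns m" "?v' \<in> balanced_columns m"
    using sub T(2) fin jT k by (auto simp: sign_vector_mem_balanced_columns_iff)
  have eq: "(\<lambda>i. if i = j then 2 else 0) = ?v + - ?v'"
    using jT assms(2) by (auto simp: sign_vector_def fun_eq_iff)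
  show thesis
  proof (cases "c = 2")
    case True
    show ?thesis
      by (rule that[OF v(1) balanced_walks.uminus_S[OF v(2)]]) (simp only: True eq)
  next
    case False
    then have "c = -2" using assms(3) by simp
    then have "(\<lambda>i. if i = j then c else 0) = - (\<lambda>i. if i = j then 2 else 0)"
      by (auto simp: fun_eq_iff)
    also have "\<dots> = ?v' + - ?v" unfolding eq by simp
    finally show ?thesis by (rule that[OF v(2) balanced_walks.uminus_S[OF v(1)]])
  qed
qed

text \<open>Builds \<open>x\<close> one coordinate at a time, each nonzero entry costing one pair of
  steps.\<close>

lemma even_vector_mem_even_span:
  fixes x :: "nat \<Rightarrow> int"
  assumes "odd m" "finite J" "J \<subseteq> {..<m}" "\<And>i. i \<in> J \<Longrightarrow> x i \<in> {2, 0, -2}" "\<And>i. i \<notin> J \<Longrightarrow> x i = 0"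
  shows "x \<in> balanced_walks.even_span m"
  using assms(2-)
proof (induction J arbitrary: x rule: finite_induct)
  case empty
  then have "x = 0" by (auto simp: fun_eq_iff)
  then show ?case by (simp only: balanced_walks.even_span.zero)
next
  case (insert j J)
  have y: "x(j := 0) \<in> balanced_walks.even_span m"
    using insert.prems insert.hyps by (intro insert.IH) auto
  show ?case
  proof (cases "x j = 0")
    case True
    then have "x(j := 0) = x" by auto
    then show ?thesis using y by simp
  next
    case False
    then have "x j \<in> {2, -2}" using insert.prems(2)[of j] by auto
    then obtain v v' where v: "v \<in> balanced_columns m" "v' \<in> balanced_columns m"
      "(\<lambda>i. if i = j then x j else 0) = v + v'"
      using double_unit_eq_sum_balanced[OF assms(1), of j "x j"] insert.prems(1) by auto
    have "x = x(j := 0) + (\<lambda>i. if i = j then x j else 0)" by (auto simp: fun_eq_iff)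
    also have "\<dots> \<in> balanced_walks.even_span m"
      unfolding v(3) using y v(1,2) by (rule balanced_walks.even_span.step)
    finally show ?thesis .
  qed
qed

text \<open>For even \<open>m\<close> the endpoint is itself a column, so one pair of steps
  suffices; for odd \<open>m\<close> the difference of two sign vectors has entries 2, 0 or
  -2.\<close>

lemma odd_endpoints_minus_mem_even_span:
  assumes "e \<in> odd_endpoints m" "v \<in> balanced_columns m"
  shows "e - v \<in> balanced_walks.even_span m"
proof (cases "even m")
  case True
  then have "e \<in> balanced_columns m" using assms(1) odd_endpoints_even by blast
  then have "0 + (e + - v) \<in> balanced_walks.even_span m"
    using assms(2) balanced_walks.uminus_S
    by (intro balanced_walks.even_span.step balanced_walks.even_span.zero)
  then show ?thesis by simp
next
  case False
  show ?thesis
  proof (rule even_vector_mem_even_span[OF False, of "{..<m}"])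
    fix i assume "i \<in> {..<m}"
    then have "e i = 1 \<or> e i = -1" "v i = 1 \<or> v i = -1"
      using odd_endpoints_eq_sign[OF assms(1), of i] assms(2) by (auto simp: balanced_columns_def)
    then show "(e - v) i \<in> {2, 0, -2}" by auto
  next
    fix i assume "i \<notin> {..<m}"
    then show "(e - v) i = 0"
      using assms by (auto simp: odd_endpoints_def cube_def balanced_columns_def)
  qed auto
qed

text \<open>With a single column the row condition is automatic, because the entries are
  signs.\<close>

lemma alpha_one: "alpha m 1 = card (balanced_columns m)"
proof -
  have "walks (balanced_columns m) 1 e = (if e \<in> balanced_columns m then 1 else 0)" for e
    by (simp add: sum.delta[OF finite_balanced_columns] eq_commute[of e])
  then have "real (alpha m 1) = real (card (cube m 1 \<inter> balanced_columns m))"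
    unfolding alpha_eq_sum_walks by (simp add: sum.If_cases finite_cube)
  then show ?thesis
    using balanced_columns_subset_cube by (simp add: Int_absorb1)
qed

theorem theorem4:
  fixes m :: nat
  assumes "m \<ge> 1"
  shows "(\<lambda>n. real (alpha m (n + 2)) / real (alpha m n)) \<longlonglongrightarrow> real ((alpha m 1)\<^sup>2)
    \<and> (alpha m 1)\<^sup>2 = ((2 * ((m + 1) div 2)) choose ((m + 1) div 2))\<^sup>2"
proof
  show "(\<lambda>n. real (alpha m (n + 2)) / real (alpha m n)) \<longlonglongrightarrow> real ((alpha m 1)\<^sup>2)"
  \<comment> \<open>Even \<open>n\<close> reduces to the return counts \<open>u\<close>, odd
    \<open>n\<close> to the sum over \<open>odd_endpoints\<close>; both subsequences have the same
    limit.\<close>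
  proof (rule limseq_even_odd)
    have "2 * k + 2 = 2 * Suc k" for k by simp
    then show "(\<lambda>k. real (alpha m (2 * k + 2)) / real (alpha m (2 * k))) \<longlonglongrightarrow> real ((alpha m 1)\<^sup>2)"
      using balanced_walks.u_ratio_tendsto[of m] by (simp only: alpha_even alpha_one of_nat_power)
    have "finite (odd_endpoints m)" "odd_endpoints m \<noteq> {}"
      using finite_cube balanced_columns_nonempty[of m] balanced_columns_subset_odd_endpoints[of m]
      by (auto simp: odd_endpoints_def simp del: One_nat_def)
    note lim = balanced_walks.odd_ratio_tendsto[OF this odd_endpoints_minus_mem_even_span]
    have "2 * k + 1 + 2 = 2 * Suc k + 1" for k by simp
    then show "(\<lambda>k. real (alpha m (2 * k + 1 + 2)) / real (alpha m (2 * k + 1)))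
        \<longlonglongrightarrow> real ((alpha m 1)\<^sup>2)"
      using lim by (simp only: alpha_odd alpha_one of_nat_power)
  qed
  show "(alpha m 1)\<^sup>2 = ((2 * ((m + 1) div 2)) choose ((m + 1) div 2))\<^sup>2"
    by (simp only: alpha_one card_balanced_columns)
qed

end
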